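(* Let $G$ be a finite connected graph of order $n\geq 3$ with $s$ support vertices and $\ell$ pendant vertices, and let $\delta^{*}(G)$ denote the minimum degree taken over all vertices of $G$ which are not pendant vertices. Then $$L_{2}(G)\leq \frac{2\bigl(n-\ell+s\,\delta^{*}(G)\bigr)}{1+\delta^{*}(G)},$$ and this bound is sharp, i.e., equality holds for some such graph $G$.
   Context: All graphs are finite and simple. For a vertex $v$, $N[v]$ is its closed neighbourhood. For an integer $k\geq 1$, a set $B\subseteq V(G)$ is a $k$-limited packing set if $|N[v]\cap B|\leq k$ for every $v\in V(G)$; the $k$-limited packing number $L_k(G)$ is the maximum cardinality of a $k$-limited packing set. A pendant vertex is a vertex of degree $1$; a support vertex is a vertex adjacent to at least one pendant vertex. *)

theory Defs
  imports Complex_Main "Graph_Theory.Graph_Theory"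
begin

(* Finite simple graphs are pair_graph structures: every edge is represented by both of its
   orientations, so the neighbours of v are its out-neighbours and its degree is its out_degree. *)

definition closed_nbhd :: "'a pair_pre_digraph \<Rightarrow> 'a \<Rightarrow> 'a set" where
  "closed_nbhd G v = insert v {u. (v, u) \<in> parcs G}"

definition limited_packing :: "nat \<Rightarrow> 'a pair_pre_digraph \<Rightarrow> 'a set \<Rightarrow> bool" where
  "limited_packing k G B \<longleftrightarrow>
     B \<subseteq> pverts G \<and> (\<forall>v \<in> pverts G. card (closed_nbhd G v \<inter> B) \<le> k)"

definition limited_packing_number :: "nat \<Rightarrow> 'a pair_pre_digraph \<Rightarrow> nat" where
  "limited_packing_number k G = Max {card B | B. limited_packing k G B}"

definition pendant_vertices :: "'a pair_pre_digraph \<Rightarrow> 'a set" where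
  "pendant_vertices G = {v \<in> pverts G. out_degree (with_proj G) v = 1}"

definition support_vertices :: "'a pair_pre_digraph \<Rightarrow> 'a set" where
  "support_vertices G = {v \<in> pverts G. \<exists>u \<in> pendant_vertices G. (v, u) \<in> parcs G}"

(* Min is unspecified on the empty set; a connected graph of order at least 3 always has a
   non-pendant vertex. *)
definition min_nonpendant_degree :: "'a pair_pre_digraph \<Rightarrow> nat" where
  "min_nonpendant_degree G =
     Min (out_degree (with_proj G) ` (pverts G - pendant_vertices G))"

end

theory Submission
  imports Defs
begin

text \<open>
  Count the pairs \<open>(v, u)\<close> with \<open>u \<in> N[v] \<inter> B\<close> and \<open>v\<close> not pendant, for a 2-limited packing set
  \<open>B\<close>. Each \<open>v\<close> contributes at most 2, so there are at most \<open>2(n - \<ell>)\<close> pairs. A vertex \<open>u \<in> B\<close> that is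
  neither pendant nor a support vertex lies in at least \<open>1 + \<delta>*\<close> pairs, any other \<open>u \<in> B\<close> in at least
  one, since in a connected graph of order at least 3 no two pendant vertices are adjacent. Vertices of
  the second kind lie in the closed neighbourhoods of support vertices, so \<open>B\<close> contains at most
  \<open>2s\<close> of them. Hence \<open>(1 + \<delta>*)|B| \<le> 2(n - \<ell>) + 2s\<delta>*\<close>. The path on three vertices attains the bound.
\<close>

section \<open>Degrees, closed neighbourhoods and pendant vertices\<close>

lemma out_degree_eq_card_nbrs:
  "out_degree (with_proj G) v = card {u. (v, u) \<in> parcs G}"
proof -
  have "out_arcs (with_proj G) v = Pair v ` {u. (v, u) \<in> parcs G}"
    by (auto simp: out_arcs_def)
  then show ?thesis
    by (simp add: out_degree_def card_image inj_on_def)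
qed

context pair_graph
begin

lemma closed_nbhd_subset_pverts: "v \<in> pverts G \<Longrightarrow> closed_nbhd G v \<subseteq> pverts G"
  by (auto simp: closed_nbhd_def dest: in_arcsD2)

lemma finite_closed_nbhd: "v \<in> pverts G \<Longrightarrow> finite (closed_nbhd G v)"
  using closed_nbhd_subset_pverts pair_finite_verts by (rule finite_subset)

lemma closed_nbhd_sym: "u \<in> closed_nbhd G v \<longleftrightarrow> v \<in> closed_nbhd G u"
  by (auto simp: closed_nbhd_def dest: arcs_symmetric)

text \<open>There are no loops, so inserting \<open>v\<close> into its set of neighbours adds
  exactly one element.\<close>

lemma card_closed_nbhd:
  assumes "v \<in> pverts G"
  shows "card (closed_nbhd G v) = Suc (out_degree (with_proj G) v)"
proof -
  have "finite {u. (v, u) \<in> parcs G}"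
    using finite_closed_nbhd[OF assms] by (simp add: closed_nbhd_def)
  moreover have "v \<notin> {u. (v, u) \<in> parcs G}"
    using no_loops' by blast
  ultimately show ?thesis
    by (simp add: closed_nbhd_def out_degree_eq_card_nbrs)
qed

lemma pendant_unique_nbr:
  assumes "v \<in> pendant_vertices G" "(v, u) \<in> parcs G" "(v, w) \<in> parcs G"
  shows "w = u"
proof -
  from assms(1) have "card {u. (v, u) \<in> parcs G} = 1"
    by (simp add: pendant_vertices_def out_degree_eq_card_nbrs)
  then obtain x where "{u. (v, u) \<in> parcs G} = {x}"
    by (rule card_1_singletonE)
  then have "u \<in> {x}" "w \<in> {x}" using assms(2,3) by blast+
  then show ?thesis by simp
qed

lemma pendant_nbr_exists:
  assumes "v \<in> pendant_vertices G"
  obtains u where "(v, u) \<in> parcs G"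
proof -
  from assms have "card {u. (v, u) \<in> parcs G} = 1"
    by (simp add: pendant_vertices_def out_degree_eq_card_nbrs)
  then obtain x where "{u. (v, u) \<in> parcs G} = {x}"
    by (rule card_1_singletonE)
  then show thesis by (auto intro: that)
qed

text \<open>Two adjacent pendant vertices have only each other as neighbours, so together they would
  be the whole connected graph, which then has order at most 2.\<close>

lemma pendants_not_adjacent:
  assumes conn: "connected (with_proj G)" and card3: "card (pverts G) \<ge> 3"
    and u: "u \<in> pendant_vertices G" and uv: "(u, v) \<in> parcs G"
  shows "v \<notin> pendant_vertices G"
proof
  assume v: "v \<in> pendant_vertices G"
  have vu: "(v, u) \<in> parcs G"
    using uv by (rule arcs_symmetric)
  \<comment> \<open>\<open>connected\<close> refers to the symmetric closure. The arcs of
    \<open>G\<close> are already symmetric, so reachability may be taken in \<open>G\<close>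
    itself.\<close>
  have "strongly_connected (with_proj G)"
    using sym_arcs conn by (rule symmetric_connected_imp_strongly_connected)
  moreover have "u \<in> pverts G"
    using uv by (rule in_arcsD1)
  ultimately have reach: "u \<rightarrow>\<^sup>*\<^bsub>with_proj G\<^esub> w" if "w \<in> pverts G" for w
    using that by (auto simp: strongly_connected_def)
  \<comment> \<open>The set \<open>{u, v}\<close> is closed under adjacency, hence under
    reachability from \<open>u\<close>.\<close>
  have "w \<in> {u, v}" if "u \<rightarrow>\<^sup>*\<^bsub>with_proj G\<^esub> w" for w
    using that
  proof (induct rule: reachable_induct)
    case base
    then show ?case by simp
  next
    case (step x y)
    then show ?case
      using pendant_unique_nbr[OF u uv] pendant_unique_nbr[OF v vu] by auto
  qed
  with reach have "pverts G \<subseteq> {u, v}" by blast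
  then have "card (pverts G) \<le> card {u, v}"
    by (intro card_mono) auto
  also have "\<dots> \<le> 2" by (simp add: card_insert_if)
  finally show False using card3 by simp
qed

text \<open>\<open>Max\<close> is meaningful here because packings are subsets of a finite vertex
  set and the empty set is a packing.\<close>

lemma limited_packing_number_maximum:
  obtains B where "limited_packing k G B" "card B = limited_packing_number k G"
    and "\<And>B'. limited_packing k G B' \<Longrightarrow> card B' \<le> limited_packing_number k G"
proof -
  let ?C = "{card B | B. limited_packing k G B}"
  have "?C \<subseteq> card ` Pow (pverts G)"
    by (auto simp: limited_packing_def)
  then have fin: "finite ?C"
    using pair_finite_verts by (meson finite_Pow_iff finite_imageI finite_subset)
  have "limited_packing k G {}"
    by (simp add: limited_packing_def)
  then have "?C \<noteq> {}" by blast
  with fin have "limited_packing_number k G \<in> ?C"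
    unfolding limited_packing_number_def by (rule Max_in)
  then obtain B where "limited_packing k G B" "card B = limited_packing_number k G"
    by auto
  moreover have "card B' \<le> limited_packing_number k G" if "limited_packing k G B'" for B'
    unfolding limited_packing_number_def using fin that by (intro Max_ge) auto
  ultimately show thesis by (rule that)
qed

section \<open>Counting estimates for limited packings\<close>

lemma min_nonpendant_degree_le:
  "v \<in> pverts G - pendant_vertices G \<Longrightarrow> min_nonpendant_degree G \<le> out_degree (with_proj G) v"
  unfolding min_nonpendant_degree_def using pair_finite_verts by (intro Min_le) auto

text \<open>A support vertex lies in its own closed neighbourhood and a pendant vertex in that of
  its neighbour, which is a support vertex. Each of these neighbourhoods meets \<open>B\<close> in
  at most \<open>k\<close> vertices.\<close>

lemma card_packing_pendant_support_le:
  assumes B: "limited_packing k G B"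
  shows "card (B \<inter> (pendant_vertices G \<union> support_vertices G)) \<le> k * card (support_vertices G)"
proof -
  have finS: "finite (support_vertices G)"
    using pair_finite_verts by (simp add: support_vertices_def)
  have SV: "support_vertices G \<subseteq> pverts G"
    by (auto simp: support_vertices_def)
  have sub: "B \<inter> (pendant_vertices G \<union> support_vertices G)
      \<subseteq> (\<Union>v\<in>support_vertices G. closed_nbhd G v \<inter> B)"
  proof
    fix u assume u: "u \<in> B \<inter> (pendant_vertices G \<union> support_vertices G)"
    show "u \<in> (\<Union>v\<in>support_vertices G. closed_nbhd G v \<inter> B)"
    proof (cases "u \<in> support_vertices G")
      case True
      with u show ?thesis by (auto simp: closed_nbhd_def)
    next
      case False
      with u have "u \<in> pendant_vertices G" by simp
      then obtain v where uv: "(u, v) \<in> parcs G" by (rule pendant_nbr_exists)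
      then have "(v, u) \<in> parcs G" by (rule arcs_symmetric)
      moreover from this \<open>u \<in> pendant_vertices G\<close> have "v \<in> support_vertices G"
        by (auto simp: support_vertices_def dest: in_arcsD1)
      ultimately show ?thesis using u by (auto simp: closed_nbhd_def)
    qed
  qed
  have "card (B \<inter> (pendant_vertices G \<union> support_vertices G))
      \<le> card (\<Union>v\<in>support_vertices G. closed_nbhd G v \<inter> B)"
    using finS SV finite_closed_nbhd by (intro card_mono[OF _ sub]) auto
  also have "\<dots> \<le> (\<Sum>v\<in>support_vertices G. card (closed_nbhd G v \<inter> B))"
    using finS by (rule card_UN_le)
  also have "\<dots> \<le> (\<Sum>v\<in>support_vertices G. k)"
    using B SV by (intro sum_mono) (auto simp: limited_packing_def)
  finally show ?thesis by (simp add: mult.commute)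
qed

text \<open>Lower bound on the number of counted pairs that contain \<open>u\<close>. The
  conditional term makes up the deficit of pendant and support vertices, for which only one pair is
  guaranteed, so that one inequality can be summed over all of \<open>B\<close>.\<close>

lemma card_closed_nbhd_minus_pendants_ge:
  assumes conn: "connected (with_proj G)" and card3: "card (pverts G) \<ge> 3"
    and u: "u \<in> pverts G"
  shows "1 + min_nonpendant_degree G \<le> card (closed_nbhd G u - pendant_vertices G)
    + (if u \<in> pendant_vertices G \<union> support_vertices G then min_nonpendant_degree G else 0)"
proof (cases "u \<in> pendant_vertices G \<union> support_vertices G")
  case True
  \<comment> \<open>The witness is the neighbour of \<open>u\<close> if \<open>u\<close> is pendant,
    and \<open>u\<close> itself otherwise.\<close>
  have "\<exists>w. w \<in> closed_nbhd G u - pendant_vertices G"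
  proof (cases "u \<in> pendant_vertices G")
    case True
    then obtain v where "(u, v) \<in> parcs G" by (rule pendant_nbr_exists)
    with pendants_not_adjacent[OF conn card3 True] show ?thesis
      by (auto simp: closed_nbhd_def)
  next
    case False
    then show ?thesis by (auto simp: closed_nbhd_def)
  qed
  then have "card (closed_nbhd G u - pendant_vertices G) > 0"
    using finite_closed_nbhd[OF u] by (auto simp: card_gt_0_iff)
  with True show ?thesis by simp
next
  case False
  \<comment> \<open>Neither \<open>u\<close> nor any of its neighbours is pendant, so nothing is
    removed and the degree bound applies.\<close>
  then have "closed_nbhd G u - pendant_vertices G = closed_nbhd G u"
    using u by (auto simp: closed_nbhd_def support_vertices_def)
  with False u show ?thesis
    using min_nonpendant_degree_le[of u] by (simp add: card_closed_nbhd)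
qed

text \<open>The double count itself, for arbitrary \<open>k\<close> and with the denominator cleared
  so that it stays in the natural numbers.\<close>

lemma card_packing_bound:
  assumes conn: "connected (with_proj G)" and card3: "card (pverts G) \<ge> 3"
    and B: "limited_packing k G B"
  shows "(1 + min_nonpendant_degree G) * card B
    \<le> k * card (pverts G - pendant_vertices G)
      + k * card (support_vertices G) * min_nonpendant_degree G"
proof -
  let ?P = "pendant_vertices G" and ?S = "support_vertices G" and ?d = "min_nonpendant_degree G"
  have BV: "B \<subseteq> pverts G" using B by (simp add: limited_packing_def)
  have finB: "finite B" using BV pair_finite_verts by (rule finite_subset)
  \<comment> \<open>By symmetry of adjacency, the non-pendant \<open>v\<close> paired with
    \<open>u\<close> can be read off the closed neighbourhood of \<open>u\<close>.\<close>
  have nbhd: "{v \<in> pverts G - ?P. u \<in> closed_nbhd G v} = closed_nbhd G u - ?P" if "u \<in> B" for u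
    using that BV closed_nbhd_subset_pverts closed_nbhd_sym by blast
  \<comment> \<open>The pairs are counted first by \<open>u\<close>, then by \<open>v\<close>, where
    the packing condition bounds each summand by \<open>k\<close>.\<close>
  have "(\<Sum>u\<in>B. card (closed_nbhd G u - ?P))
      = (\<Sum>v\<in>pverts G - ?P. card {u \<in> B. u \<in> closed_nbhd G v})"
    using finB pair_finite_verts nbhd by (intro sum_multicount_gen[symmetric]) auto
  also have "\<dots> \<le> (\<Sum>v\<in>pverts G - ?P. k)"
  proof (rule sum_mono)
    fix v assume "v \<in> pverts G - ?P"
    moreover have "{u \<in> B. u \<in> closed_nbhd G v} = closed_nbhd G v \<inter> B" by blast
    ultimately show "card {u \<in> B. u \<in> closed_nbhd G v} \<le> k"
      using B by (simp add: limited_packing_def)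
  qed
  finally have count: "(\<Sum>u\<in>B. card (closed_nbhd G u - ?P)) \<le> k * card (pverts G - ?P)"
    by (simp add: mult.commute)
  have "(1 + ?d) * card B = (\<Sum>u\<in>B. 1 + ?d)" by simp
  also have "\<dots> \<le> (\<Sum>u\<in>B. card (closed_nbhd G u - ?P) + (if u \<in> ?P \<union> ?S then ?d else 0))"
    using BV by (intro sum_mono card_closed_nbhd_minus_pendants_ge[OF conn card3]) auto
  also have "\<dots> = (\<Sum>u\<in>B. card (closed_nbhd G u - ?P)) + card (B \<inter> (?P \<union> ?S)) * ?d"
    using finB by (simp add: sum.distrib sum.inter_restrict[symmetric] del: Un_iff)
  also have "\<dots> \<le> k * card (pverts G - ?P) + (k * card ?S) * ?d"
    using count card_packing_pendant_support_le[OF B] by (intro add_mono mult_right_mono) auto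
  finally show ?thesis .
qed

lemma limited_packing_number_bound:
  assumes conn: "connected (with_proj G)" and card3: "card (pverts G) \<ge> 3"
  shows "real (limited_packing_number k G) \<le>
    k * (real (card (pverts G)) - real (card (pendant_vertices G))
       + real (card (support_vertices G)) * real (min_nonpendant_degree G))
     / (1 + real (min_nonpendant_degree G))"
proof -
  have PV: "pendant_vertices G \<subseteq> pverts G" by (auto simp: pendant_vertices_def)
  have nonpendant: "real (card (pverts G)) - real (card (pendant_vertices G))
      = real (card (pverts G - pendant_vertices G))"
    using PV pair_finite_verts
    by (simp add: card_Diff_subset finite_subset card_mono of_nat_diff)
  obtain B where B: "limited_packing k G B" "card B = limited_packing_number k G"
    by (rule limited_packing_number_maximum)
  have "real ((1 + min_nonpendant_degree G) * card B)
    \<le> real (k * card (pverts G - pendant_vertices G)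
      + k * card (support_vertices G) * min_nonpendant_degree G)"
    using card_packing_bound[OF conn card3 B(1)] by (simp only: of_nat_le_iff)
  then show ?thesis
    unfolding nonpendant B(2) by (simp add: pos_le_divide_eq algebra_simps)
qed

end

section \<open>Sharpness: the path on three vertices\<close>

definition path3 :: "nat pair_pre_digraph" where
  "path3 = \<lparr>pverts = {0, 1, 2}, parcs = {(0, 1), (1, 0), (1, 2), (2, 1)}\<rparr>"

lemma pair_graph_path3: "pair_graph path3"
  by unfold_locales (auto simp: path3_def symmetric_def sym_def)

lemma connected_path3: "connected (with_proj path3)"
proof -
  interpret pair_graph path3 by (rule pair_graph_path3)
  \<comment> \<open>The centre \<open>1\<close> serves as a hub: any two vertices are joined through
    it.\<close>
  have to1: "u \<rightarrow>\<^sup>*\<^bsub>with_proj path3\<^esub> 1" and from1: "1 \<rightarrow>\<^sup>*\<^bsub>with_proj path3\<^esub> u"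
    if "u \<in> pverts path3" for u
  proof -
    have "u = 1 \<or> (u, 1) \<in> parcs path3 \<and> (1, u) \<in> parcs path3"
      using that by (auto simp: path3_def)
    then show "u \<rightarrow>\<^sup>*\<^bsub>with_proj path3\<^esub> 1" "1 \<rightarrow>\<^sup>*\<^bsub>with_proj path3\<^esub> u"
      using that by (auto intro: reachable_adjI)
  qed
  have "u \<rightarrow>\<^sup>*\<^bsub>with_proj path3\<^esub> v" if "u \<in> pverts path3" "v \<in> pverts path3" for u v
    using to1[OF that(1)] from1[OF that(2)] by (rule reachable_trans)
  then have "u \<rightarrow>\<^sup>*\<^bsub>with_proj (mk_symmetric (with_proj path3))\<^esub> v"
    if "u \<in> pverts path3" "v \<in> pverts path3" for u v
    using that by (blast intro: reachable_mk_symmetricI)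
  moreover have "pverts path3 \<noteq> {}"
    by (simp add: path3_def)
  ultimately show ?thesis
    unfolding connected_def by (intro strongly_connectedI) (simp_all add: mk_symmetric_def)
qed

lemma out_degree_path3:
  "out_degree (with_proj path3) 0 = 1"
  "out_degree (with_proj path3) 1 = 2"
  "out_degree (with_proj path3) 2 = 1"
proof -
  have "{u. (0, u) \<in> parcs path3} = {1}" "{u. (1, u) \<in> parcs path3} = {0, 2}"
    "{u. (2, u) \<in> parcs path3} = {1}"
    by (auto simp: path3_def)
  then show "out_degree (with_proj path3) 0 = 1" "out_degree (with_proj path3) 1 = 2"
    "out_degree (with_proj path3) 2 = 1"
    by (simp_all add: out_degree_eq_card_nbrs)
qed

lemma pverts_path3: "pverts path3 = {0, 1, 2}"
  by (simp add: path3_def)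

lemma pendant_vertices_path3: "pendant_vertices path3 = {0, 2}"
  using out_degree_path3 by (auto simp: pendant_vertices_def pverts_path3)

lemma support_vertices_path3: "support_vertices path3 = {1}"
  by (auto simp: support_vertices_def pendant_vertices_path3) (auto simp: path3_def)

lemma min_nonpendant_degree_path3: "min_nonpendant_degree path3 = 2"
proof -
  have "pverts path3 - pendant_vertices path3 = {1}"
    by (auto simp: pverts_path3 pendant_vertices_path3)
  then show ?thesis
    using out_degree_path3(2) by (simp add: min_nonpendant_degree_def)
qed

text \<open>The general bound evaluates to 2 here, and the two end vertices form a packing of that
  size.\<close>

lemma limited_packing_number_path3: "limited_packing_number 2 path3 = 2"
proof (rule antisym)
  interpret pair_graph path3 by (rule pair_graph_path3)
  have "real (limited_packing_number 2 path3) \<le> 2"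
    using limited_packing_number_bound[OF connected_path3, of 2]
    by (simp add: pverts_path3 pendant_vertices_path3 support_vertices_path3
        min_nonpendant_degree_path3)
  then show "limited_packing_number 2 path3 \<le> 2" by simp
  \<comment> \<open>A set of two vertices meets any closed neighbourhood in at most two
    elements.\<close>
  have "card (A \<inter> {0, 2}) \<le> 2" for A :: "nat set"
    using card_mono[of "{0, 2}" "A \<inter> {0, 2}"] by simp
  then have "limited_packing 2 path3 {0, 2}"
    by (simp add: limited_packing_def pverts_path3)
  then have "card {0, 2::nat} \<le> limited_packing_number 2 path3"
    by (meson limited_packing_number_maximum)
  then show "2 \<le> limited_packing_number 2 path3" by simp
qed

theorem theorem1:
  shows "(\<forall>G :: 'a pair_pre_digraph.
            pair_graph G \<and> connected (with_proj G) \<and> card (pverts G) \<ge> 3 \<longrightarrow>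
            real (limited_packing_number 2 G) \<le>
              2 * (real (card (pverts G)) - real (card (pendant_vertices G))
                   + real (card (support_vertices G)) * real (min_nonpendant_degree G))
                / (1 + real (min_nonpendant_degree G)))
       \<and> (\<exists>H :: nat pair_pre_digraph.
            pair_graph H \<and> connected (with_proj H) \<and> card (pverts H) \<ge> 3 \<and>
            real (limited_packing_number 2 H) =
              2 * (real (card (pverts H)) - real (card (pendant_vertices H))
                   + real (card (support_vertices H)) * real (min_nonpendant_degree H))
                / (1 + real (min_nonpendant_degree H)))"
proof (intro conjI allI impI)
  fix G :: "'a pair_pre_digraph"
  assume "pair_graph G \<and> connected (with_proj G) \<and> card (pverts G) \<ge> 3"
  then show "real (limited_packing_number 2 G) \<le>
              2 * (real (card (pverts G)) - real (card (pendant_vertices G))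
                   + real (card (support_vertices G)) * real (min_nonpendant_degree G))
                / (1 + real (min_nonpendant_degree G))"
    using pair_graph.limited_packing_number_bound[of G 2] by simp
next
  show "\<exists>H :: nat pair_pre_digraph.
            pair_graph H \<and> connected (with_proj H) \<and> card (pverts H) \<ge> 3 \<and>
            real (limited_packing_number 2 H) =
              2 * (real (card (pverts H)) - real (card (pendant_vertices H))
                   + real (card (support_vertices H)) * real (min_nonpendant_degree H))
                / (1 + real (min_nonpendant_degree H))"
    \<comment> \<open>Order 3, two pendant vertices, one support vertex and minimum non-pendant
      degree 2 give 2 * (3 - 2 + 1 * 2) / (1 + 2) = 2.\<close>
    using pair_graph_path3 connected_path3
    by (intro exI[of _ path3])
      (simp add: limited_packing_number_path3 pverts_path3 pendant_vertices_path3
        support_vertices_path3 min_nonpendant_degree_path3)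
qed

end
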